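(* Let $(P,\omega_P)$ be a closed symplectic manifold with $[\omega_P]\in H^2(P;\mathbb Q)$ that admits a Hamiltonian $\mathbb T^k$-action $\phi:\mathbb T^k\times P\to P$ with moment map $\mu:P\to\mathbb R^k$, where $\mathbb T^k=\mathbb R^k/\mathbb Z^k$. For $a\in\mathbb R^k$ let $\phi_a:P\to P$ be the Hamiltonian diffeomorphism given by the action of $a\bmod\mathbb Z^k$ (generated by the Hamiltonian $\langle\mu,a\rangle$). Then $\phi_a$ is Hofer near-periodic for any $a\in\mathbb R^k$.
   Context: A symplectomorphism $\Phi:P\to P$ is Hofer near-periodic if there exist Hamiltonian diffeomorphisms $\phi_i\in\mathrm{Ham}(P,\omega_P)$ and positive integers $T_i$ such that $\phi_i\circ\Phi$ is $T_i$-periodic (i.e. $(\phi_i\circ\Phi)^{T_i}=\mathrm{Id}$) and $\|\phi_i\|_H\cdot T_i\to0$ as $i\to\infty$. Here $\|\phi\|_H$ is the standard Hofer norm of a Hamiltonian diffeomorphism, i.e. the infimum over all Hamiltonians $h:\mathbb R/\mathbb Z\times P\to\mathbb R$ generating $\phi$ at time $1$ of $\int_0^1(\max_xh(t,x)-\min_xh(t,x))\,dt$. *)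

theory Defs
  imports "HOL-Analysis.Analysis" "HOL-Homology.Homology"
begin

section \<open>Smooth maps between open subsets of normed spaces\<close>

text \<open>Differentiability of every order, by iterated directional derivatives. These notions are only
  applied to open sets in finite-dimensional spaces, where they are the usual $C^k$ and $C^\infty$.\<close>

primrec Ck_on :: "nat \<Rightarrow> 'a::real_normed_vector set \<Rightarrow> ('a \<Rightarrow> 'b::real_normed_vector) \<Rightarrow> bool" where
  "Ck_on 0 S f \<longleftrightarrow> continuous_on S f"
| "Ck_on (Suc k) S f \<longleftrightarrow>
     (\<forall>x\<in>S. f differentiable (at x)) \<and> (\<forall>v. Ck_on k S (\<lambda>x. frechet_derivative f (at x) v))"

definition smooth_on :: "'a::real_normed_vector set \<Rightarrow> ('a \<Rightarrow> 'b::real_normed_vector) \<Rightarrow> bool" where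
  "smooth_on S f \<longleftrightarrow> (\<forall>k. Ck_on k S f)"


section \<open>Smooth manifolds\<close>

text \<open>A manifold is given by a topology \<open>X\<close> together with a smooth atlas \<open>A\<close>, not necessarily
  maximal. A chart is a pair of its domain and its coordinate map into the model space \<open>'e\<close>.
  Only the values of the coordinate map on the domain matter.\<close>

type_synonym ('p, 'e) chart = "'p set \<times> ('p \<Rightarrow> 'e)"

abbreviation cdom :: "('p, 'e) chart \<Rightarrow> 'p set" where "cdom \<equiv> fst"
abbreviation cmap :: "('p, 'e) chart \<Rightarrow> 'p \<Rightarrow> 'e" where "cmap \<equiv> snd"
abbreviation cimage :: "('p, 'e) chart \<Rightarrow> 'e set" where "cimage c \<equiv> cmap c ` cdom c"
abbreviation cinv :: "('p, 'e) chart \<Rightarrow> 'e \<Rightarrow> 'p" where "cinv c \<equiv> inv_into (cdom c) (cmap c)"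

definition smooth_atlas :: "'p topology \<Rightarrow> ('p, 'e::euclidean_space) chart set \<Rightarrow> bool" where
  "smooth_atlas X A \<longleftrightarrow>
     (\<forall>c\<in>A. openin X (cdom c) \<and> open (cimage c) \<and>
        homeomorphic_map (subtopology X (cdom c)) (top_of_set (cimage c)) (cmap c)) \<and>
     (\<Union>c\<in>A. cdom c) = topspace X \<and>
     (\<forall>c\<in>A. \<forall>d\<in>A. smooth_on (cmap c ` (cdom c \<inter> cdom d)) (cmap d \<circ> cinv c))"

definition smooth_manifold :: "'p topology \<Rightarrow> ('p, 'e::euclidean_space) chart set \<Rightarrow> bool" where
  "smooth_manifold X A \<longleftrightarrow> Hausdorff_space X \<and> second_countable X \<and> smooth_atlas X A"

text \<open>Nonemptiness is part of the definition, as the Hofer norm involves the maximum and the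
  minimum of a function on the manifold. Connectedness is not assumed.\<close>

definition closed_manifold :: "'p topology \<Rightarrow> ('p, 'e::euclidean_space) chart set \<Rightarrow> bool" where
  "closed_manifold X A \<longleftrightarrow> smooth_manifold X A \<and> compact_space X \<and> topspace X \<noteq> {}"

definition smooth_fun :: "('p, 'e::euclidean_space) chart set \<Rightarrow> ('p \<Rightarrow> 'v::real_normed_vector) \<Rightarrow> bool" where
  "smooth_fun A f \<longleftrightarrow> (\<forall>c\<in>A. smooth_on (cimage c) (f \<circ> cinv c))"

definition smooth_map ::
  "'p topology \<Rightarrow> ('p, 'e::euclidean_space) chart set \<Rightarrow> ('p \<Rightarrow> 'p) \<Rightarrow> bool" where
  "smooth_map X A f \<longleftrightarrow> continuous_map X X f \<and>
     (\<forall>c\<in>A. \<forall>d\<in>A. smooth_on (cmap c ` {p \<in> cdom c. f p \<in> cdom d}) (cmap d \<circ> f \<circ> cinv c))"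

definition diffeomorphism ::
  "'p topology \<Rightarrow> ('p, 'e::euclidean_space) chart set \<Rightarrow> ('p \<Rightarrow> 'p) \<Rightarrow> bool" where
  "diffeomorphism X A f \<longleftrightarrow> smooth_map X A f \<and>
     (\<exists>g. smooth_map X A g \<and> (\<forall>p\<in>topspace X. g (f p) = p \<and> f (g p) = p))"

text \<open>Maps from an open subset of a normed space into the manifold.\<close>

definition smooth_into ::
  "'p topology \<Rightarrow> ('p, 'e::euclidean_space) chart set \<Rightarrow> 't::real_normed_vector set \<Rightarrow> ('t \<Rightarrow> 'p) \<Rightarrow> bool" where
  "smooth_into X A W g \<longleftrightarrow> continuous_map (top_of_set W) X g \<and>
     (\<forall>c\<in>A. smooth_on {w \<in> W. g w \<in> cdom c} (cmap c \<circ> g))"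

text \<open>Families of functions, respectively of self-maps, that depend on a parameter in a normed space
  and are smooth jointly in the parameter and the point.\<close>

definition smooth_fun_family ::
  "('p, 'e::euclidean_space) chart set \<Rightarrow> ('t::real_normed_vector \<Rightarrow> 'p \<Rightarrow> 'v::real_normed_vector) \<Rightarrow> bool" where
  "smooth_fun_family A h \<longleftrightarrow> (\<forall>c\<in>A. smooth_on (UNIV \<times> cimage c) (\<lambda>(t, x). h t (cinv c x)))"

definition smooth_map_family ::
  "'p topology \<Rightarrow> ('p, 'e::euclidean_space) chart set \<Rightarrow> ('t::real_normed_vector \<Rightarrow> 'p \<Rightarrow> 'p) \<Rightarrow> bool" where
  "smooth_map_family X A F \<longleftrightarrow>
     continuous_map (prod_topology euclidean X) X (\<lambda>(t, p). F t p) \<and>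
     (\<forall>c\<in>A. \<forall>d\<in>A. smooth_on {(t, x). x \<in> cimage c \<and> F t (cinv c x) \<in> cdom d}
                           (\<lambda>(t, x). cmap d (F t (cinv c x))))"


section \<open>Symplectic forms\<close>

text \<open>Tangent vectors at a point \<open>p\<close> of \<open>cdom c\<close> are represented by their coordinates in \<open>c\<close>.
  A 2-form \<open>\<omega>\<close> is the family of its coordinate expressions: \<open>\<omega> c p u v\<close> is its value on the tangent
  vectors at \<open>p\<close> with coordinates \<open>u\<close>, \<open>v\<close> in \<open>c\<close>.\<close>

type_synonym ('p, 'e) form2 = "('p, 'e) chart \<Rightarrow> 'p \<Rightarrow> 'e \<Rightarrow> 'e \<Rightarrow> real"

definition two_form :: "('p, 'e::euclidean_space) chart set \<Rightarrow> ('p, 'e) form2 \<Rightarrow> bool" where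
  "two_form A \<omega> \<longleftrightarrow>
     (\<forall>c\<in>A. \<forall>p\<in>cdom c. bilinear (\<omega> c p) \<and> (\<forall>v. \<omega> c p v v = 0)) \<and>
     (\<forall>c\<in>A. \<forall>u v. smooth_on (cimage c) (\<lambda>x. \<omega> c (cinv c x) u v)) \<and>
     (\<forall>c\<in>A. \<forall>d\<in>A. \<forall>p\<in>cdom c \<inter> cdom d. \<forall>u v.
        (let D = frechet_derivative (cmap d \<circ> cinv c) (at (cmap c p))
         in \<omega> c p u v = \<omega> d p (D u) (D v)))"

text \<open>The condition $d\omega(u,v,w) = 0$ for coordinate vectors \<open>u\<close>, \<open>v\<close>, \<open>w\<close>, extended to constant
  vector fields in the chart, for which all Lie brackets vanish.\<close>

definition closed_form :: "('p, 'e::euclidean_space) chart set \<Rightarrow> ('p, 'e) form2 \<Rightarrow> bool" where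
  "closed_form A \<omega> \<longleftrightarrow> (\<forall>c\<in>A. \<forall>x\<in>cimage c. \<forall>u v w.
     frechet_derivative (\<lambda>y. \<omega> c (cinv c y) v w) (at x) u +
     frechet_derivative (\<lambda>y. \<omega> c (cinv c y) w u) (at x) v +
     frechet_derivative (\<lambda>y. \<omega> c (cinv c y) u v) (at x) w = 0)"

definition nondegenerate_form :: "('p, 'e::euclidean_space) chart set \<Rightarrow> ('p, 'e) form2 \<Rightarrow> bool" where
  "nondegenerate_form A \<omega> \<longleftrightarrow>
     (\<forall>c\<in>A. \<forall>p\<in>cdom c. \<forall>u. (\<forall>v. \<omega> c p u v = 0) \<longrightarrow> u = 0)"

definition symplectic_form :: "('p, 'e::euclidean_space) chart set \<Rightarrow> ('p, 'e) form2 \<Rightarrow> bool" where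
  "symplectic_form A \<omega> \<longleftrightarrow> two_form A \<omega> \<and> closed_form A \<omega> \<and> nondegenerate_form A \<omega>"

definition closed_symplectic_manifold ::
  "'p topology \<Rightarrow> ('p, 'e::euclidean_space) chart set \<Rightarrow> ('p, 'e) form2 \<Rightarrow> bool" where
  "closed_symplectic_manifold X A \<omega> \<longleftrightarrow> closed_manifold X A \<and> symplectic_form A \<omega>"

definition symplectomorphism ::
  "'p topology \<Rightarrow> ('p, 'e::euclidean_space) chart set \<Rightarrow> ('p, 'e) form2 \<Rightarrow> ('p \<Rightarrow> 'p) \<Rightarrow> bool" where
  "symplectomorphism X A \<omega> f \<longleftrightarrow> diffeomorphism X A f \<and>
     (\<forall>c\<in>A. \<forall>d\<in>A. \<forall>p. p \<in> cdom c \<and> f p \<in> cdom d \<longrightarrow> (\<forall>u v.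
        (let D = frechet_derivative (cmap d \<circ> f \<circ> cinv c) (at (cmap c p))
         in \<omega> d (f p) (D u) (D v) = \<omega> c p u v)))"


section \<open>Rational cohomology classes\<close>

definition simplex_point :: "real \<times> real \<Rightarrow> nat \<Rightarrow> real" where
  "simplex_point = (\<lambda>(s, t) i. if i = 0 then 1 - s - t else if i = 1 then s else if i = 2 then t else 0)"

definition triangle :: "(real \<times> real) set" where
  "triangle = {(s, t). 0 \<le> s \<and> 0 \<le> t \<and> s + t \<le> 1}"

definition smooth_simplex2 ::
  "'p topology \<Rightarrow> ('p, 'e::euclidean_space) chart set \<Rightarrow> ((nat \<Rightarrow> real) \<Rightarrow> 'p) \<Rightarrow> bool" where
  "smooth_simplex2 X A \<sigma> \<longleftrightarrow> singular_simplex 2 X \<sigma> \<and>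
     (\<exists>W g. open W \<and> triangle \<subseteq> W \<and> smooth_into X A W g \<and>
        (\<forall>w\<in>triangle. g w = \<sigma> (simplex_point w)))"

text \<open>The integral of a 2-form over a smooth simplex. It is taken over the interior of the triangle,
  where the simplex is differentiable as a map on the plane; the integrand does not depend on the
  choice of the chart.\<close>

definition simplex_integral ::
  "('p, 'e::euclidean_space) chart set \<Rightarrow> ('p, 'e) form2 \<Rightarrow> ((nat \<Rightarrow> real) \<Rightarrow> 'p) \<Rightarrow> real" where
  "simplex_integral A \<omega> \<sigma> = integral (interior triangle) (\<lambda>w.
     (let g = \<sigma> \<circ> simplex_point;
          c = (SOME c. c \<in> A \<and> g w \<in> cdom c);
          D = frechet_derivative (cmap c \<circ> g) (at w)
      in \<omega> c (g w) (D (1, 0)) (D (0, 1))))"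

definition cochain_eval :: "(((nat \<Rightarrow> real) \<Rightarrow> 'p) \<Rightarrow> 'b::comm_ring_1) \<Rightarrow> 'p chain \<Rightarrow> 'b" where
  "cochain_eval \<alpha> z = (\<Sum>\<sigma>\<in>Poly_Mapping.keys z. of_int (Poly_Mapping.lookup z \<sigma>) * \<alpha> \<sigma>)"

text \<open>The de Rham class of \<open>\<omega>\<close> lies in the image of $H^2(X;\mathbb{Q})$ in $H^2(X;\mathbb{R})$: on smooth
  simplices, integration of \<open>\<omega>\<close> agrees with some rational singular 2-cocycle \<open>\<alpha>\<close> up to the coboundary
  of a real 1-cochain \<open>\<beta>\<close>.\<close>

definition rational_class ::
  "'p topology \<Rightarrow> ('p, 'e::euclidean_space) chart set \<Rightarrow> ('p, 'e) form2 \<Rightarrow> bool" where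
  "rational_class X A \<omega> \<longleftrightarrow>
     (\<exists>(\<alpha> :: ((nat \<Rightarrow> real) \<Rightarrow> 'p) \<Rightarrow> rat) (\<beta> :: ((nat \<Rightarrow> real) \<Rightarrow> 'p) \<Rightarrow> real).
        (\<forall>z. singular_chain 3 X z \<longrightarrow> cochain_eval \<alpha> (chain_boundary 3 z) = 0) \<and>
        (\<forall>\<sigma>. smooth_simplex2 X A \<sigma> \<longrightarrow>
           simplex_integral A \<omega> \<sigma> =
             of_rat (\<alpha> \<sigma>) + cochain_eval \<beta> (chain_boundary 2 (frag_of \<sigma>))))"


section \<open>Hamiltonian diffeomorphisms and the Hofer norm\<close>

text \<open>The sign convention is $\iota_{X_H}\omega = dH$; here \<open>v\<close> are the coordinates in \<open>c\<close> of a tangent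
  vector at \<open>p\<close>.\<close>

definition hamiltonian_vector ::
  "('p, 'e::euclidean_space) form2 \<Rightarrow> ('p \<Rightarrow> real) \<Rightarrow> ('p, 'e) chart \<Rightarrow> 'p \<Rightarrow> 'e \<Rightarrow> bool" where
  "hamiltonian_vector \<omega> H c p v \<longleftrightarrow>
     (\<forall>w. \<omega> c p v w = frechet_derivative (H \<circ> cinv c) (at (cmap c p)) w)"

definition velocity :: "('p, 'e::euclidean_space) chart \<Rightarrow> (real \<Rightarrow> 'p) \<Rightarrow> real \<Rightarrow> 'e" where
  "velocity c \<gamma> t = vector_derivative (cmap c \<circ> \<gamma>) (at t)"

text \<open>Hamiltonians $\mathbb{R}/\mathbb{Z} \times P \to \mathbb{R}$ are represented by functions on
  $\mathbb{R} \times P$ that are 1-periodic in the first argument.\<close>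

definition time_periodic_hamiltonian ::
  "'p topology \<Rightarrow> ('p, 'e::euclidean_space) chart set \<Rightarrow> (real \<Rightarrow> 'p \<Rightarrow> real) \<Rightarrow> bool" where
  "time_periodic_hamiltonian X A h \<longleftrightarrow>
     smooth_fun_family A h \<and> (\<forall>t. \<forall>p\<in>topspace X. h (t + 1) p = h t p)"

definition hamiltonian_flow ::
  "'p topology \<Rightarrow> ('p, 'e::euclidean_space) chart set \<Rightarrow> ('p, 'e) form2 \<Rightarrow>
     (real \<Rightarrow> 'p \<Rightarrow> real) \<Rightarrow> (real \<Rightarrow> 'p \<Rightarrow> 'p) \<Rightarrow> bool" where
  "hamiltonian_flow X A \<omega> h \<psi> \<longleftrightarrow>
     smooth_map_family X A \<psi> \<and> (\<forall>p\<in>topspace X. \<psi> 0 p = p) \<and>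
     (\<forall>t. \<forall>p\<in>topspace X. \<forall>c\<in>A. \<psi> t p \<in> cdom c \<longrightarrow>
        hamiltonian_vector \<omega> (h t) c (\<psi> t p) (velocity c (\<lambda>s. \<psi> s p) t))"

definition generates ::
  "'p topology \<Rightarrow> ('p, 'e::euclidean_space) chart set \<Rightarrow> ('p, 'e) form2 \<Rightarrow>
     (real \<Rightarrow> 'p \<Rightarrow> real) \<Rightarrow> ('p \<Rightarrow> 'p) \<Rightarrow> bool" where
  "generates X A \<omega> h f \<longleftrightarrow> time_periodic_hamiltonian X A h \<and>
     (\<exists>\<psi>. hamiltonian_flow X A \<omega> h \<psi> \<and> (\<forall>p\<in>topspace X. \<psi> 1 p = f p))"

definition Ham ::
  "'p topology \<Rightarrow> ('p, 'e::euclidean_space) chart set \<Rightarrow> ('p, 'e) form2 \<Rightarrow> ('p \<Rightarrow> 'p) set" where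
  "Ham X A \<omega> = {f. \<exists>h. generates X A \<omega> h f}"

text \<open>On a closed manifold the supremum and the infimum are attained.\<close>

definition oscillation :: "'p topology \<Rightarrow> ('p \<Rightarrow> real) \<Rightarrow> real" where
  "oscillation X H = (SUP p\<in>topspace X. H p) - (INF p\<in>topspace X. H p)"

definition hofer_norm ::
  "'p topology \<Rightarrow> ('p, 'e::euclidean_space) chart set \<Rightarrow> ('p, 'e) form2 \<Rightarrow> ('p \<Rightarrow> 'p) \<Rightarrow> real" where
  "hofer_norm X A \<omega> f =
     Inf {integral {0..1} (\<lambda>t. oscillation X (h t)) | h. generates X A \<omega> h f}"

definition hofer_near_periodic ::
  "'p topology \<Rightarrow> ('p, 'e::euclidean_space) chart set \<Rightarrow> ('p, 'e) form2 \<Rightarrow> ('p \<Rightarrow> 'p) \<Rightarrow> bool" where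
  "hofer_near_periodic X A \<omega> \<Phi> \<longleftrightarrow> symplectomorphism X A \<omega> \<Phi> \<and>
     (\<exists>(f :: nat \<Rightarrow> 'p \<Rightarrow> 'p) (T :: nat \<Rightarrow> nat).
        (\<forall>i. f i \<in> Ham X A \<omega> \<and> 0 < T i \<and>
             (\<forall>p\<in>topspace X. ((f i \<circ> \<Phi>) ^^ T i) p = p)) \<and>
        (\<lambda>i. hofer_norm X A \<omega> (f i) * real (T i)) \<longlonglongrightarrow> 0)"


section \<open>Hamiltonian torus actions\<close>

text \<open>A smooth action of $\mathbb{T}^k = \mathbb{R}^k/\mathbb{Z}^k$ is given as a smooth action of
  $\mathbb{R}^k$ that is invariant under translation of the parameter by $\mathbb{Z}^k$.\<close>

definition smooth_torus_action ::
  "'p topology \<Rightarrow> ('p, 'e::euclidean_space) chart set \<Rightarrow> (real ^ 'k \<Rightarrow> 'p \<Rightarrow> 'p) \<Rightarrow> bool" where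
  "smooth_torus_action X A \<phi> \<longleftrightarrow>
     smooth_map_family X A \<phi> \<and>
     (\<forall>p\<in>topspace X. \<phi> 0 p = p) \<and>
     (\<forall>a b. \<forall>p\<in>topspace X. \<phi> (a + b) p = \<phi> a (\<phi> b p)) \<and>
     (\<forall>a z. (\<forall>i. z $ i \<in> \<int>) \<longrightarrow> (\<forall>p\<in>topspace X. \<phi> (a + z) p = \<phi> a p))"

text \<open>The action is by symplectomorphisms, the infinitesimal action of \<open>b\<close> is the Hamiltonian vector
  field of $\langle\mu, b\rangle$, and \<open>\<mu>\<close> is equivariant, which for a torus means invariant.\<close>

definition hamiltonian_torus_action ::
  "'p topology \<Rightarrow> ('p, 'e::euclidean_space) chart set \<Rightarrow> ('p, 'e) form2 \<Rightarrow>
     (real ^ 'k \<Rightarrow> 'p \<Rightarrow> 'p) \<Rightarrow> ('p \<Rightarrow> real ^ 'k) \<Rightarrow> bool" where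
  "hamiltonian_torus_action X A \<omega> \<phi> \<mu> \<longleftrightarrow>
     smooth_torus_action X A \<phi> \<and>
     (\<forall>a. symplectomorphism X A \<omega> (\<phi> a)) \<and>
     smooth_fun A \<mu> \<and>
     (\<forall>b. \<forall>c\<in>A. \<forall>p\<in>cdom c.
        hamiltonian_vector \<omega> (\<lambda>q. \<mu> q \<bullet> b) c p (velocity c (\<lambda>s. \<phi> (s *\<^sub>R b) p) 0)) \<and>
     (\<forall>a. \<forall>p\<in>topspace X. \<mu> (\<phi> a p) = \<mu> p)"

end

theory Submission
  imports Defs
begin

text \<open>By Dirichlet's simultaneous approximation theorem there are integers \<open>q > 0\<close> and integer
  vectors \<open>z\<close> with \<open>q a - z\<close> arbitrarily small. With $b = z / q - a$, the map
  $\phi_b \circ \phi_a = \phi_{z/q}$ is \<open>q\<close>-periodic, while the autonomous Hamiltonian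
  $\langle\mu, b\rangle$ bounds the Hofer norm of $\phi_b$ by a constant times $|b|$, and
  $q\,|b| = |q a - z|$.\<close>

section \<open>Smoothness under linear maps\<close>

text \<open>Derivatives are taken with the filter \<open>at x\<close>, so they depend on values in a
  full neighbourhood of \<open>x\<close>. Openness of \<open>T\<close> makes \<open>f\<close> and
  \<open>g\<close> agree on such a neighbourhood; their directional derivatives then agree on
  \<open>T\<close>, and the induction on the order repeats the argument for these.\<close>

lemma Ck_on_cong:
  assumes "open T" "\<And>x. x \<in> T \<Longrightarrow> f x = g x" "Ck_on k T f"
  shows "Ck_on k T g"
  using assms(2,3)
proof (induction k arbitrary: f g)
  case 0
  then show ?case by (simp cong: continuous_on_cong)
next
  case (Suc k)
  have diff: "f differentiable (at x)" if "x \<in> T" for x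
    using Suc.prems that by simp
  have "g differentiable (at x)" if "x \<in> T" for x
    using diff[OF that] has_derivative_transform_within_open[of f _ x UNIV T g,
        OF _ \<open>open T\<close> that Suc.prems(1)]
    unfolding differentiable_def by blast
  moreover have "Ck_on k T (\<lambda>x. frechet_derivative g (at x) v)" for v
  proof (rule Suc.IH)
    show "Ck_on k T (\<lambda>x. frechet_derivative f (at x) v)"
      using Suc.prems by simp
    show "frechet_derivative f (at x) v = frechet_derivative g (at x) v" if "x \<in> T" for x
      using frechet_derivative_transform_within_open[OF diff[OF that] \<open>open T\<close> that Suc.prems(1)]
      by simp
  qed
  ultimately show ?case by simp
qed

text \<open>By the chain rule the derivative of \<open>R \<circ> f \<circ> L\<close> in direction
  \<open>v\<close> is \<open>R\<close> after the derivative of \<open>f\<close> in the fixed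
  direction \<open>L v\<close>, after \<open>L\<close>. This has the same shape with
  \<open>f\<close> replaced by a directional derivative, so induction on the order closes with no
  product rule.\<close>

lemma Ck_on_bounded_linear_compose:
  assumes "open T" "bounded_linear L" "bounded_linear R"
    and "\<And>x. x \<in> T \<Longrightarrow> L x \<in> S" "Ck_on k S f"
  shows "Ck_on k T (\<lambda>x. R (f (L x)))"
  using assms(5)
proof (induction k arbitrary: f)
  case 0
  then have "continuous_on S f"
    by simp
  then have "continuous_on T (\<lambda>x. f (L x))"
    by (rule continuous_on_compose2[OF _ linear_continuous_on[OF assms(2)]]) (use assms(4) in blast)
  then show ?case
    unfolding Ck_on.simps by (rule bounded_linear.continuous_on[OF assms(3)])
next
  case (Suc k)
  have D: "((\<lambda>x. R (f (L x))) has_derivative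
      (\<lambda>v. R (frechet_derivative f (at (L x)) (L v)))) (at x)" if "x \<in> T" for x
  proof -
    have "(f has_derivative frechet_derivative f (at (L x))) (at (L x))"
      using Suc.prems assms(4)[OF that] by (simp add: frechet_derivative_works)
    from diff_chain_at[OF bounded_linear_imp_has_derivative[OF assms(2)] this]
    show ?thesis
      using bounded_linear.has_derivative[OF assms(3)] by (simp add: o_def)
  qed
  have "Ck_on k T (\<lambda>x. frechet_derivative (\<lambda>x. R (f (L x))) (at x) v)" for v
  proof (rule Ck_on_cong[OF \<open>open T\<close>])
    show "Ck_on k T (\<lambda>x. R (frechet_derivative f (at (L x)) (L v)))"
      using Suc.prems by (intro Suc.IH) simp
    show "R (frechet_derivative f (at (L x)) (L v)) =
        frechet_derivative (\<lambda>x. R (f (L x))) (at x) v" if "x \<in> T" for x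
      using frechet_derivative_at[OF D[OF that]] by metis
  qed
  then show ?case
    using D by (auto simp: differentiable_def)
qed

lemma smooth_on_bounded_linear_compose:
  assumes "open T" "bounded_linear L" "bounded_linear R"
    and "\<And>x. x \<in> T \<Longrightarrow> L x \<in> S" "smooth_on S f"
  shows "smooth_on T (\<lambda>x. R (f (L x)))"
  using assms Ck_on_bounded_linear_compose unfolding smooth_on_def by blast

section \<open>Continuity in charts\<close>

lemma smooth_atlasD:
  assumes "smooth_atlas X A" "c \<in> A"
  shows "openin X (cdom c)" "open (cimage c)"
    "homeomorphic_map (subtopology X (cdom c)) (top_of_set (cimage c)) (cmap c)"
    "topspace X \<inter> cdom c = cdom c"
proof -
  show op: "openin X (cdom c)" and "open (cimage c)"
    and "homeomorphic_map (subtopology X (cdom c)) (top_of_set (cimage c)) (cmap c)"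
    using assms by (simp_all add: smooth_atlas_def)
  show "topspace X \<inter> cdom c = cdom c"
    using openin_subset[OF op] by blast
qed

lemma cinv_cmap:
  assumes "smooth_atlas X A" "c \<in> A" "p \<in> cdom c"
  shows "cinv c (cmap c p) = p"
proof -
  have "inj_on (cmap c) (cdom c)"
    using homeomorphic_imp_injective_map[OF smooth_atlasD(3)[OF assms(1,2)]]
    by (simp add: smooth_atlasD(4)[OF assms(1,2)])
  then show ?thesis
    using assms(3) by simp
qed

lemma continuous_map_cinv:
  assumes "smooth_atlas X A" "c \<in> A"
  shows "continuous_map (top_of_set (cimage c)) X (cinv c)"
proof -
  obtain g where g: "homeomorphic_maps (subtopology X (cdom c)) (top_of_set (cimage c)) (cmap c) g"
    using smooth_atlasD(3)[OF assms] unfolding homeomorphic_map_maps ..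
  \<comment> \<open>\<open>cinv c\<close> is an \<open>inv_into\<close>, defined by choice; it
    inherits continuity from the topological inverse \<open>g\<close> because the two agree on the
    image of the chart.\<close>
  have "g y = cinv c y" if "y \<in> cimage c" for y
  proof -
    from that obtain p where p: "p \<in> cdom c" "y = cmap c p"
      by (rule imageE)
    moreover have "g (cmap c p) = p"
      using g p(1) by (simp add: homeomorphic_maps_def smooth_atlasD(4)[OF assms])
    ultimately show ?thesis
      using cinv_cmap[OF assms p(1)] by simp
  qed
  moreover have "continuous_map (top_of_set (cimage c)) X g"
    using g continuous_map_into_fulltopology unfolding homeomorphic_maps_def by metis
  ultimately show ?thesis
    by (rule continuous_map_eq[rotated]) simp
qed

text \<open>The chart domains are an open cover, and on each of them \<open>f\<close> is its
  coordinate expression after the continuous coordinate map, so the pasting lemma applies. With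
  compactness this yields the boundedness of Hamiltonians and of the moment map.\<close>

lemma continuous_map_charts:
  assumes "smooth_atlas X A" "\<And>c. c \<in> A \<Longrightarrow> continuous_on (cimage c) (f \<circ> cinv c)"
  shows "continuous_map X euclidean f"
proof (rule pasting_lemma[where I = A and T = cdom and f = "\<lambda>_. f"])
  show "continuous_map (subtopology X (cdom c)) euclidean f" if "c \<in> A" for c
  proof (rule continuous_map_eq)
    have "continuous_map (top_of_set (cimage c)) euclidean (f \<circ> cinv c)"
      using assms(2)[OF that] by simp
    then show "continuous_map (subtopology X (cdom c)) euclidean ((f \<circ> cinv c) \<circ> cmap c)"
      by (rule continuous_map_compose[OF
            homeomorphic_imp_continuous_map[OF smooth_atlasD(3)[OF assms(1) that]]])
  qed (use cinv_cmap[OF assms(1) that] in auto)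
  show "\<exists>c. c \<in> A \<and> p \<in> cdom c \<and> f p = f p" if "p \<in> topspace X" for p
    using assms(1) that unfolding smooth_atlas_def by blast
qed (use smooth_atlasD(1)[OF assms(1)] in auto)

lemma bounded_range_if_continuous_map:
  fixes f :: "'p \<Rightarrow> 'v::real_normed_vector"
  assumes "compact_space X" "continuous_map X euclidean f"
  shows "bounded (f ` topspace X)"
proof -
  have "compactin euclidean (f ` topspace X)"
    using assms image_compactin unfolding compact_space_def by blast
  then show ?thesis
    by (simp add: compact_imp_bounded)
qed

section \<open>Oscillation and Hofer norm\<close>

text \<open>Boundedness makes the real-valued \<open>SUP\<close> and \<open>INF\<close> genuine
  bounds; the value at any single point lies between them.\<close>

lemma oscillation_nonneg:
  assumes "topspace X \<noteq> {}" "bounded (H ` topspace X)"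
  shows "0 \<le> oscillation X H"
proof -
  obtain p where "p \<in> topspace X"
    using assms(1) by blast
  then show ?thesis
    using cINF_lower[of H "topspace X" p] cSUP_upper[of p "topspace X" H] assms(2)
    by (simp add: oscillation_def bounded_imp_bdd_above bounded_imp_bdd_below)
qed

lemma oscillation_le:
  assumes "topspace X \<noteq> {}" "\<And>p. p \<in> topspace X \<Longrightarrow> \<bar>H p\<bar> \<le> B"
  shows "oscillation X H \<le> 2 * B"
proof -
  have "(SUP p\<in>topspace X. H p) \<le> B" "- B \<le> (INF p\<in>topspace X. H p)"
    using assms by (auto intro!: cSUP_least cINF_greatest simp: abs_le_iff minus_le_iff)
  then show ?thesis
    by (simp add: oscillation_def)
qed

text \<open>This gives 0 as a lower bound of the set whose \<open>Inf\<close> is the Hofer norm.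
  Each \<open>h t\<close> is continuous in the charts, hence bounded on the compact space.\<close>

lemma integral_oscillation_nonneg:
  assumes "closed_manifold X A" "generates X A \<omega> h f"
  shows "0 \<le> integral {0..1} (\<lambda>t. oscillation X (h t))"
proof -
  have atlas: "smooth_atlas X A" and compact: "compact_space X" and ne: "topspace X \<noteq> {}"
    using assms(1) by (auto simp: closed_manifold_def smooth_manifold_def)
  have "0 \<le> oscillation X (h t)" for t
  proof (rule oscillation_nonneg[OF ne bounded_range_if_continuous_map[OF compact]])
    show "continuous_map X euclidean (h t)"
    proof (rule continuous_map_charts[OF atlas])
      fix c assume "c \<in> A"
      then have "smooth_on (UNIV \<times> cimage c) (\<lambda>(t, x). h t (cinv c x))"
        using assms(2)
        unfolding generates_def time_periodic_hamiltonian_def smooth_fun_family_def by blast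
      then have "continuous_on (UNIV \<times> cimage c) (\<lambda>(t, x). h t (cinv c x))"
        unfolding smooth_on_def by (metis Ck_on.simps(1))
      moreover have "continuous_on (cimage c) (\<lambda>x. (t, x))"
        by (intro continuous_intros)
      ultimately have "continuous_on (cimage c) (\<lambda>x. (\<lambda>(t, x). h t (cinv c x)) (t, x))"
        by (rule continuous_on_compose2) blast
      then show "continuous_on (cimage c) (h t \<circ> cinv c)"
        by (simp add: o_def)
    qed
  qed
  \<comment> \<open>Integrability of the oscillation in time is not established: if it fails, the
    integral has the default value 0, which also satisfies the bound.\<close>
  then show ?thesis
    by (cases "(\<lambda>t. oscillation X (h t)) integrable_on {0..1}")
      (auto intro: integral_nonneg simp: not_integrable_integral)
qed

lemma hofer_norm_le:
  assumes "closed_manifold X A" "generates X A \<omega> h f"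
  shows "hofer_norm X A \<omega> f \<le> integral {0..1} (\<lambda>t. oscillation X (h t))"
  unfolding hofer_norm_def
  using assms integral_oscillation_nonneg[OF assms(1)]
  by (intro cInf_lower bdd_belowI[of _ 0]) auto

text \<open>The generator \<open>h\<close> makes the set under the infimum nonempty; the real number
  \<open>Inf {}\<close> would be unspecified.\<close>

lemma hofer_norm_nonneg:
  assumes "closed_manifold X A" "generates X A \<omega> h f"
  shows "0 \<le> hofer_norm X A \<omega> f"
  unfolding hofer_norm_def
  using assms integral_oscillation_nonneg[OF assms(1)]
  by (intro cInf_greatest) auto

section \<open>One-parameter subgroups of a torus action\<close>

text \<open>\<open>vector_derivative\<close> is a choice among all derivatives. Showing that both
  sides admit exactly the same candidates \<open>v\<close> identifies the two choices even where no
  derivative exists.\<close>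

lemma vector_derivative_shift:
  fixes g :: "real \<Rightarrow> 'a::real_normed_vector"
  shows "vector_derivative (\<lambda>s. g (s - t)) (at t) = vector_derivative g (at 0)"
proof -
  have "((\<lambda>s. g (s - t)) has_vector_derivative v) (at t) \<longleftrightarrow>
      (g has_vector_derivative v) (at 0)" for v
  proof
    assume "(g has_vector_derivative v) (at 0)"
    then have "(g has_vector_derivative v) (at (t - t))"
      by simp
    moreover have "((\<lambda>s. s - t) has_vector_derivative 1) (at t)"
      by (auto intro!: derivative_eq_intros)
    ultimately show "((\<lambda>s. g (s - t)) has_vector_derivative v) (at t)"
      using vector_diff_chain_at[of "\<lambda>s. s - t" 1 t g v] by (simp add: o_def)
  next
    assume "((\<lambda>s. g (s - t)) has_vector_derivative v) (at t)"
    then have "((\<lambda>s. g (s - t)) has_vector_derivative v) (at (0 + t))"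
      by simp
    moreover have "((\<lambda>s. s + t) has_vector_derivative 1) (at 0)"
      by (auto intro!: derivative_eq_intros)
    ultimately show "(g has_vector_derivative v) (at 0)"
      using vector_diff_chain_at[of "\<lambda>s. s + t" 1 0 "\<lambda>s. g (s - t)" v] by (simp add: o_def)
  qed
  then show ?thesis
    by (simp add: vector_derivative_def)
qed

lemma smooth_map_family_in_topspace:
  assumes "smooth_map_family X A F" "p \<in> topspace X"
  shows "F t p \<in> topspace X"
proof -
  have "continuous_map (prod_topology euclidean X) X (\<lambda>(t, p). F t p)"
    using assms(1) by (simp add: smooth_map_family_def)
  from continuous_map_image_subset_topspace[OF this] assms(2) show ?thesis
    by force
qed

text \<open>Taking for \<open>L\<close> the map \<open>t \<mapsto> t *\<^sub>R b\<close> restricts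
  the torus action to a one-parameter subgroup. In charts this is precomposition with the linear map
  \<open>(t, x) \<mapsto> (L t, x)\<close>.\<close>

lemma smooth_map_family_bounded_linear:
  fixes A :: "('p, 'e::euclidean_space) chart set"
    and L :: "'s::real_normed_vector \<Rightarrow> 't::real_normed_vector"
  assumes "smooth_atlas X A" "smooth_map_family X A F" "bounded_linear L"
  shows "smooth_map_family X A (\<lambda>t. F (L t))"
proof -
  have contF: "continuous_map (prod_topology euclidean X) X (\<lambda>(s, p). F s p)"
    using assms(2) by (simp add: smooth_map_family_def)
  have "continuous_map (prod_topology euclidean X) (prod_topology euclidean X)
      (\<lambda>x. ((L \<circ> fst) x, snd x))"
    by (intro continuous_map_pairedI continuous_map_snd continuous_map_compose[OF continuous_map_fst])
      (simp add: linear_continuous_on assms(3))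
  from continuous_map_compose[OF this contF]
  have cont: "continuous_map (prod_topology euclidean X) X (\<lambda>(t, p). F (L t) p)"
    by (simp add: o_def case_prod_unfold)
  moreover have "smooth_on {(t, x). x \<in> cimage c \<and> F (L t) (cinv c x) \<in> cdom d}
      (\<lambda>(t, x). cmap d (F (L t) (cinv c x)))" (is "smooth_on ?T _") if "c \<in> A" "d \<in> A" for c d
  proof -
    have opens: "open (cimage c)" "openin X (cdom d)"
      using assms(1) that by (auto simp: smooth_atlas_def)
    have eq: "top_of_set (UNIV \<times> cimage c) =
        prod_topology (euclidean :: 's topology) (top_of_set (cimage c))"
      using subtopology_Times[of euclidean euclidean "UNIV :: 's set" "cimage c"] by simp
    have "continuous_map (top_of_set (UNIV \<times> cimage c)) (prod_topology euclidean X)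
        (\<lambda>x :: 's \<times> _. (fst x, (cinv c \<circ> snd) x))"
      unfolding eq by (intro continuous_map_pairedI continuous_map_fst
          continuous_map_compose[OF continuous_map_snd] continuous_map_cinv[OF assms(1) that(1)])
    from continuous_map_compose[OF this cont]
    have "continuous_map (top_of_set (UNIV \<times> cimage c)) X (\<lambda>(t, x). F (L t) (cinv c x))"
      by (simp add: o_def case_prod_unfold)
    from openin_continuous_map_preimage[OF this opens(2)]
    \<comment> \<open>The domain of the coordinate expression is the preimage of an open chart
      domain under a continuous map, hence open, as the linear composition lemma demands.\<close>
    have "openin (top_of_set (UNIV \<times> cimage c)) ?T"
      by (rule back_subst[where P = "openin _"]) auto
    then have openT: "open ?T"
      using opens(1) by (simp add: openin_open_eq open_Times)
    have bl: "bounded_linear (\<lambda>x :: 's \<times> 'e. (L (fst x), snd x))"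
      by (intro bounded_linear_Pair bounded_linear_compose[OF assms(3)] bounded_linear_fst
          bounded_linear_snd)
    have smooth: "smooth_on {(s, x). x \<in> cimage c \<and> F s (cinv c x) \<in> cdom d}
        (\<lambda>(s, x). cmap d (F s (cinv c x)))"
      using assms(2) that by (simp add: smooth_map_family_def)
    have "smooth_on ?T (\<lambda>x. (\<lambda>(s, x). cmap d (F s (cinv c x))) (L (fst x), snd x))"
      by (rule smooth_on_bounded_linear_compose[OF openT bl bounded_linear_ident _ smooth]) auto
    then show ?thesis
      by (simp add: case_prod_unfold)
  qed
  ultimately show ?thesis
    by (simp add: smooth_map_family_def)
qed

text \<open>The flow is \<open>t \<mapsto> \<phi> (t *\<^sub>R b)\<close>, which starts at the
  identity and reaches \<open>\<phi> b\<close> at time 1. The Hamiltonian is autonomous, so its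
  1-periodicity in time is trivial.\<close>

lemma generates_torus_element:
  assumes "smooth_atlas X A" "hamiltonian_torus_action X A \<omega> \<phi> \<mu>"
  shows "generates X A \<omega> (\<lambda>_ p. \<mu> p \<bullet> b) (\<phi> b)"
proof -
  have act: "smooth_map_family X A \<phi>" "\<And>p. p \<in> topspace X \<Longrightarrow> \<phi> 0 p = p"
      "\<And>a b p. p \<in> topspace X \<Longrightarrow> \<phi> (a + b) p = \<phi> a (\<phi> b p)"
    and \<mu>: "smooth_fun A \<mu>"
    and ham: "\<And>c p. c \<in> A \<Longrightarrow> p \<in> cdom c \<Longrightarrow>
      hamiltonian_vector \<omega> (\<lambda>q. \<mu> q \<bullet> b) c p (velocity c (\<lambda>s. \<phi> (s *\<^sub>R b) p) 0)"
    using assms(2) unfolding hamiltonian_torus_action_def smooth_torus_action_def by blast+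
  have "smooth_on (UNIV \<times> cimage c) (\<lambda>(t::real, x). \<mu> (cinv c x) \<bullet> b)" if "c \<in> A" for c
  proof -
    have "smooth_on (cimage c) (\<mu> \<circ> cinv c)" "open ((UNIV :: real set) \<times> cimage c)"
      using \<mu> that smooth_atlasD(2)[OF assms(1) that]
      by (auto simp only: smooth_fun_def open_Times open_UNIV)
    \<comment> \<open>The coordinate expression of \<open>\<mu>\<close> is placed between two linear
      maps, the projection \<open>snd\<close> and the functional
      \<open>\<lambda>x. x \<bullet> b\<close>.\<close>
    then have "smooth_on (UNIV \<times> cimage c) (\<lambda>x :: real \<times> _. (\<mu> \<circ> cinv c) (snd x) \<bullet> b)"
      by (intro smooth_on_bounded_linear_compose[where S = "cimage c" and f = "\<mu> \<circ> cinv c" and R = "\<lambda>x. x \<bullet> b"]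
          bounded_linear_snd bounded_linear_inner_left) auto
    then show ?thesis
      by (simp add: case_prod_unfold)
  qed
  moreover have "smooth_map_family X A (\<lambda>t. \<phi> (t *\<^sub>R b))"
    using assms(1) act(1) by (rule smooth_map_family_bounded_linear) (rule bounded_linear_scaleR_left)
  moreover have "hamiltonian_vector \<omega> (\<lambda>q. \<mu> q \<bullet> b) c (\<phi> (t *\<^sub>R b) p)
      (velocity c (\<lambda>s. \<phi> (s *\<^sub>R b) p) t)"
    if "p \<in> topspace X" "c \<in> A" "\<phi> (t *\<^sub>R b) p \<in> cdom c" for t p c
  proof -
    \<comment> \<open>The action specifies velocities only at time 0. The group law turns the orbit
      of \<open>p\<close> near time \<open>t\<close> into the orbit of
      \<open>\<phi> (t *\<^sub>R b) p\<close> near time 0.\<close>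
    have "\<phi> (s *\<^sub>R b) p = \<phi> ((s - t) *\<^sub>R b) (\<phi> (t *\<^sub>R b) p)" for s
      using act(3)[OF that(1), of "(s - t) *\<^sub>R b" "t *\<^sub>R b"] by (simp add: scaleR_left_diff_distrib)
    then have "velocity c (\<lambda>s. \<phi> (s *\<^sub>R b) p) t =
        velocity c (\<lambda>s. \<phi> ((s - t) *\<^sub>R b) (\<phi> (t *\<^sub>R b) p)) t"
      unfolding velocity_def o_def by (metis (no_types))
    also have "\<dots> = velocity c (\<lambda>s. \<phi> (s *\<^sub>R b) (\<phi> (t *\<^sub>R b) p)) 0"
      unfolding velocity_def o_def by (rule vector_derivative_shift)
    finally show ?thesis
      using ham[OF that(2,3)] by simp
  qed
  ultimately show ?thesis
    unfolding generates_def hamiltonian_flow_def time_periodic_hamiltonian_def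
      smooth_fun_family_def
    by (intro conjI exI[of _ "\<lambda>t. \<phi> (t *\<^sub>R b)"]) (auto simp: act(2))
qed

text \<open>The autonomous generator is one competitor in the infimum, and its integral over unit
  time is its oscillation. Cauchy-Schwarz bounds its absolute value by \<open>C * norm b\<close>;
  the factor 2 comes from passing to maximum minus minimum.\<close>

lemma hofer_norm_torus_element_le:
  assumes "closed_manifold X A" "hamiltonian_torus_action X A \<omega> \<phi> \<mu>"
    and "\<And>p. p \<in> topspace X \<Longrightarrow> norm (\<mu> p) \<le> C"
  shows "hofer_norm X A \<omega> (\<phi> b) \<le> 2 * C * norm b"
proof -
  have "smooth_atlas X A" "topspace X \<noteq> {}"
    using assms(1) unfolding closed_manifold_def smooth_manifold_def by blast+
  then have "hofer_norm X A \<omega> (\<phi> b) \<le> integral {0..1::real} (\<lambda>_. oscillation X (\<lambda>p. \<mu> p \<bullet> b))"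
    using hofer_norm_le[OF assms(1) generates_torus_element] assms(2) by blast
  also have "\<dots> = oscillation X (\<lambda>p. \<mu> p \<bullet> b)"
    by simp
  also have "\<dots> \<le> 2 * (C * norm b)"
  proof (rule oscillation_le[OF \<open>topspace X \<noteq> {}\<close>])
    fix p assume "p \<in> topspace X"
    then have "norm (\<mu> p) * norm b \<le> C * norm b"
      using assms(3) by (simp add: mult_right_mono)
    then show "\<bar>\<mu> p \<bullet> b\<bar> \<le> C * norm b"
      using Cauchy_Schwarz_ineq2 order_trans by blast
  qed
  finally show ?thesis
    by simp
qed

lemma smooth_torus_action_funpow:
  assumes "smooth_torus_action X A \<phi>" "p \<in> topspace X"
  shows "((\<phi> b \<circ> \<phi> a) ^^ n) p = \<phi> (real n *\<^sub>R (b + a)) p"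
proof (induction n)
  case 0
  then show ?case
    using assms by (simp add: smooth_torus_action_def)
next
  case (Suc n)
  let ?q = "\<phi> (real n *\<^sub>R (b + a)) p"
  have add: "\<phi> (u + v) r = \<phi> u (\<phi> v r)" if "r \<in> topspace X" for u v r
    using assms(1) that unfolding smooth_torus_action_def by blast
  \<comment> \<open>The group law holds only at points of the manifold, so the iterate must stay in
    it.\<close>
  have "?q \<in> topspace X"
    using assms(1) unfolding smooth_torus_action_def
    by (elim conjE) (rule smooth_map_family_in_topspace[OF _ assms(2)])
  then have "\<phi> b (\<phi> a ?q) = \<phi> ((b + a) + real n *\<^sub>R (b + a)) p"
    using assms(2) by (simp only: add)
  also have "(b + a) + real n *\<^sub>R (b + a) = real (Suc n) *\<^sub>R (b + a)"
    by (simp add: algebra_simps)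
  finally show ?case
    using Suc.IH by simp
qed

section \<open>Simultaneous Diophantine approximation of vectors\<close>

lemma Dirichlet_approx_vec:
  fixes a :: "real ^ 'k"
  assumes "0 < N"
  obtains q :: nat and z :: "real ^ 'k" where "0 < q" "\<And>i. z $ i \<in> \<int>"
    "norm (z - real q *\<^sub>R a) \<le> real CARD('k) / real N"
proof -
  \<comment> \<open>Dirichlet's theorem treats families indexed by the naturals below
    \<open>n\<close>; \<open>h\<close> enumerates the coordinates in this way.\<close>
  obtain h :: "'k \<Rightarrow> nat" where h: "bij_betw h UNIV {0..<CARD('k)}"
    using ex_bij_betw_finite_nat[OF finite_class.finite_UNIV] by blast
  then have hinv: "inv_into UNIV h (h i) = i" "h i < CARD('k)" for i
    by (auto simp: bij_betw_def inv_f_f)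
  obtain q p where qp: "0 < q"
    "\<And>j. j < CARD('k) \<Longrightarrow> \<bar>of_int q * a $ inv_into UNIV h j - of_int (p j)\<bar> < 1 / real N"
    using Dirichlet_approx_simult[OF assms, where n = "CARD('k)" and \<theta> = "\<lambda>j. a $ inv_into UNIV h j"]
    by metis
  define z :: "real ^ 'k" where "z = (\<chi> i. of_int (p (h i)))"
  have "\<bar>(z - real (nat q) *\<^sub>R a) $ i\<bar> \<le> 1 / real N" for i
    using qp(1) qp(2)[OF hinv(2), of i] by (simp add: z_def hinv(1) abs_minus_commute)
  \<comment> \<open>The Euclidean norm is at most the sum of the coordinate errors, each at most
    \<open>1 / N\<close>; this is where the factor \<open>CARD('k)\<close> arises.\<close>
  then have "norm (z - real (nat q) *\<^sub>R a) \<le> (\<Sum>i\<in>(UNIV::'k set). 1 / real N)"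
    by (intro order_trans[OF norm_le_l1_cart] sum_mono)
  then show ?thesis
    using qp(1) by (intro that[of "nat q" z]) (auto simp: z_def)
qed

section \<open>Rational perturbations of the torus parameter and their limit\<close>

theorem proposition5p30:
  fixes X :: "'p topology"
    and A :: "('p, 'e::euclidean_space) chart set"
    and \<omega> :: "('p, 'e) form2"
    and \<phi> :: "real ^ 'k \<Rightarrow> 'p \<Rightarrow> 'p"
    and \<mu> :: "'p \<Rightarrow> real ^ 'k"
    and a :: "real ^ 'k"
  assumes "closed_symplectic_manifold X A \<omega>"
    and "rational_class X A \<omega>"
    and "hamiltonian_torus_action X A \<omega> \<phi> \<mu>"
  shows "hofer_near_periodic X A \<omega> (\<phi> a)"
proof -
  have closed: "closed_manifold X A"
    using assms(1) by (simp add: closed_symplectic_manifold_def)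
  then have atlas: "smooth_atlas X A" and compact: "compact_space X"
    by (auto simp: closed_manifold_def smooth_manifold_def)
  have act: "smooth_torus_action X A \<phi>" and symp: "symplectomorphism X A \<omega> (\<phi> a)"
    and \<mu>: "smooth_fun A \<mu>"
    using assms(3) by (auto simp: hamiltonian_torus_action_def)
  have "continuous_on (cimage c) (\<mu> \<circ> cinv c)" if "c \<in> A" for c
    using \<mu> that unfolding smooth_fun_def smooth_on_def by (metis Ck_on.simps(1))
  then obtain C where C: "\<And>p. p \<in> topspace X \<Longrightarrow> norm (\<mu> p) \<le> C"
    using bounded_range_if_continuous_map[OF compact continuous_map_charts[OF atlas]]
    unfolding bounded_iff by (metis imageI)
  \<comment> \<open>Dirichlet's theorem is applied with \<open>N = Suc n\<close>, which is positive
    for every \<open>n\<close> and tends to infinity.\<close>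
  have "\<forall>n. \<exists>q z. 0 < q \<and> (\<forall>i. z $ i \<in> \<int>) \<and>
      norm (z - real q *\<^sub>R a) \<le> real CARD('k) / real (Suc n)"
    using Dirichlet_approx_vec[OF zero_less_Suc, of a] by metis
  then obtain T z where T: "\<And>n. 0 < T n" and z: "\<And>n i. z n $ i \<in> \<int>"
    and approx: "\<And>n. norm (z n - real (T n) *\<^sub>R a) \<le> real CARD('k) / real (Suc n)"
    by metis
  \<comment> \<open>The correction moves \<open>a\<close> to the rational point
    \<open>z n / T n\<close>, so \<open>T n\<close> steps add up to the integer vector
    \<open>z n\<close>.\<close>
  define b where "b n = (1 / real (T n)) *\<^sub>R z n - a" for n
  have Tb: "real (T n) *\<^sub>R (b n + a) = z n" "real (T n) *\<^sub>R b n = z n - real (T n) *\<^sub>R a" for n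
    using T[of n] by (simp_all add: b_def algebra_simps)
  have gen: "generates X A \<omega> (\<lambda>_ p. \<mu> p \<bullet> b n) (\<phi> (b n))" for n
    using atlas assms(3) by (rule generates_torus_element)
  have periodic: "((\<phi> (b n) \<circ> \<phi> a) ^^ T n) p = p" if "p \<in> topspace X" for n p
  proof -
    \<comment> \<open>Integer vectors act as 0 does; the form \<open>0 + z n\<close> matches the
      translation invariance of the action.\<close>
    have "\<phi> (0 + z n) p = \<phi> 0 p" "\<phi> 0 p = p"
      using act z that unfolding smooth_torus_action_def by blast+
    then show ?thesis
      using smooth_torus_action_funpow[OF act that] by (simp add: Tb(1))
  qed
  \<comment> \<open>A point of the manifold is needed to conclude \<open>0 \<le> C\<close>, which
    later permits multiplying an inequality by \<open>2 * C\<close>.\<close>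
  obtain p where "p \<in> topspace X"
    using closed unfolding closed_manifold_def by blast
  then have "0 \<le> C"
    using C norm_ge_zero order_trans by blast
  have bound: "hofer_norm X A \<omega> (\<phi> (b n)) * real (T n) \<le> 2 * C * real CARD('k) / real (Suc n)" for n
  proof -
    have "hofer_norm X A \<omega> (\<phi> (b n)) * real (T n) \<le> 2 * C * norm (b n) * real (T n)"
      using hofer_norm_torus_element_le[OF closed assms(3) C] by (simp add: mult_right_mono)
    also have "\<dots> = 2 * C * norm (real (T n) *\<^sub>R b n)"
      by simp
    \<comment> \<open>The period is absorbed here: \<open>T n\<close> times \<open>b n\<close> is
      the Dirichlet error itself, whose bound does not involve \<open>T n\<close>.\<close>
    also have "\<dots> \<le> 2 * C * (real CARD('k) / real (Suc n))"
      unfolding Tb(2) using \<open>0 \<le> C\<close> approx by (intro mult_left_mono) auto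
    finally show ?thesis
      by simp
  qed
  have "(\<lambda>n. hofer_norm X A \<omega> (\<phi> (b n)) * real (T n)) \<longlonglongrightarrow> 0"
  proof (rule tendsto_sandwich[OF _ _ tendsto_const])
    show "(\<lambda>n. 2 * C * real CARD('k) / real (Suc n)) \<longlonglongrightarrow> 0"
      by (rule LIMSEQ_Suc[OF lim_const_over_n])
  qed (use hofer_norm_nonneg[OF closed gen] bound in auto)
  moreover have "\<phi> (b n) \<in> Ham X A \<omega>" for n
    using gen unfolding Ham_def by blast
  ultimately show ?thesis
    unfolding hofer_near_periodic_def using symp T periodic
    by (intro conjI exI[of _ "\<lambda>n. \<phi> (b n)"] exI[of _ T]) auto
qed

end
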